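(* Let $H$ be a real Hilbert space, $C\subset H$ nonempty closed convex with metric projection $P$, and $A,F:H\to H$ satisfying: (A1) $A$ is $\lambda$-strongly monotone and $L_A$-Lipschitz continuous, $F$ is $L_F$-Lipschitz continuous, and $A,F$ are sequentially weak-to-weak continuous; (A2) the couple $(A,F)$ is monotone; (A3) $\mathrm{Sol}(A,F,C)\neq\emptyset$ and $A(\mathrm{Sol}(A,F,C))$ is convex. Let $\alpha,\mu:[0,\infty)\to(0,\infty)$ be continuous functions. Then for every $x_0\in H$ the Cauchy problem $$\dot x(t)=P\big(F_{\alpha(t)}x(t)-\mu(t)Ax(t)\big)-F_{\alpha(t)}x(t),\qquad x(0)=x_0,$$ where $F_{\alpha}:=F+\alpha I$, admits a unique strong global solution.
   Context: $\mathrm{Sol}(A,F,C)$ is the solution set of $\mathrm{GVI}(A,F,C)$: find $x^*\in H$ with $Fx^*\in C$ and $\langle Ax^*,y-Fx^*\rangle\ge0$ for all $y\in C$. The couple $(A,F)$ is monotone if $\langle Ax-Ay,Fx-Fy\rangle\ge0$ for all $x,y$. Sequentially weak-to-weak continuous: $x^k\rightharpoonup\bar x$ implies $Ax^k\rightharpoonup A\bar x$. A strong global solution is a function $x:[0,\infty)\to H$ that is absolutely continuous on every interval $[0,T]$, $T<\infty$, satisfies the differential equation for almost every $t\ge0$, and satisfies $x(0)=x_0$. *)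

theory Defs
  imports "HOL-Analysis.Analysis"
begin

definition metric_proj :: "'a::real_inner set \<Rightarrow> 'a \<Rightarrow> 'a" where
  "metric_proj C x = (THE y. y \<in> C \<and> (\<forall>z\<in>C. dist x y \<le> dist x z))"

definition weak_conv :: "(nat \<Rightarrow> 'a::real_inner) \<Rightarrow> 'a \<Rightarrow> bool" where
  "weak_conv xs x \<longleftrightarrow> (\<forall>y. (\<lambda>k. inner (xs k) y) \<longlonglongrightarrow> inner x y)"

definition seq_weak_weak_continuous :: "('a::real_inner \<Rightarrow> 'a) \<Rightarrow> bool" where
  "seq_weak_weak_continuous A \<longleftrightarrow>
     (\<forall>xs x. weak_conv xs x \<longrightarrow> weak_conv (\<lambda>k. A (xs k)) (A x))"

definition strongly_monotone :: "real \<Rightarrow> ('a::real_inner \<Rightarrow> 'a) \<Rightarrow> bool" where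
  "strongly_monotone lam A \<longleftrightarrow> lam > 0 \<and>
     (\<forall>x y. inner (A x - A y) (x - y) \<ge> lam * (norm (x - y))\<^sup>2)"

definition monotone_couple :: "('a::real_inner \<Rightarrow> 'a) \<Rightarrow> ('a \<Rightarrow> 'a) \<Rightarrow> bool" where
  "monotone_couple A F \<longleftrightarrow> (\<forall>x y. inner (A x - A y) (F x - F y) \<ge> 0)"

definition GVI_Sol :: "('a::real_inner \<Rightarrow> 'a) \<Rightarrow> ('a \<Rightarrow> 'a) \<Rightarrow> 'a set \<Rightarrow> 'a set" where
  "GVI_Sol A F C = {x. F x \<in> C \<and> (\<forall>y\<in>C. inner (A x) (y - F x) \<ge> 0)}"

definition absolutely_continuous_on :: "real set \<Rightarrow> (real \<Rightarrow> 'a::real_normed_vector) \<Rightarrow> bool" where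
  "absolutely_continuous_on I f \<longleftrightarrow>
    (\<forall>\<epsilon>>0. \<exists>\<delta>>0. \<forall>S. finite S \<and> (\<forall>(a,b)\<in>S. a \<le> b \<and> {a..b} \<subseteq> I)
        \<and> disjoint_family_on (\<lambda>(a,b). {a<..<b}) S
        \<and> (\<Sum>(a,b)\<in>S. b - a) < \<delta>
        \<longrightarrow> (\<Sum>(a,b)\<in>S. norm (f b - f a)) < \<epsilon>)"

definition strong_global_solution ::
  "(real \<Rightarrow> 'a::real_normed_vector \<Rightarrow> 'a) \<Rightarrow> 'a \<Rightarrow> (real \<Rightarrow> 'a) \<Rightarrow> bool" where
  "strong_global_solution G x0 x \<longleftrightarrow>
     (\<forall>T\<ge>0. absolutely_continuous_on {0..T} x)
     \<and> (AE t in lborel. t \<ge> 0 \<longrightarrow> (x has_vector_derivative G t (x t)) (at t))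
     \<and> x 0 = x0"

end

theory Submission
  imports Defs
begin

text \<open>The projection onto a closed convex set is nonexpansive, so the right-hand side is continuous
  in time and Lipschitz in space with a constant \<open>K t\<close> that depends continuously on time. With the
  weight \<open>exp (2 \<integral>\<^sub>0\<^sup>t K)\<close>, the Picard operator is a contraction of the bounded continuous functions
  on the whole half-line, which gives a global solution in one step. Conversely, an absolutely
  continuous function whose derivative vanishes almost everywhere is constant; hence every strong
  solution solves the integral equation, and two such solutions agree by the same weighted estimate.\<close>

section \<open>Projection and Riesz representation in Hilbert spaces\<close>

text \<open>Since \<open>K\<close> may be unbounded on the half-line, no step length works uniformly
  for a local Picard argument; the weight grows with the integral of \<open>K\<close> and so makes
  gluing of local solutions and a separate exclusion of blow-up unnecessary. For the Picard operator
  to map the weighted space into itself, \<open>K\<close> must also dominate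
  \<open>norm (G t 0)\<close>. In the converse direction, a derivative that exists only almost
  everywhere does not by itself determine the increments of a function, as Cantor-type functions
  show; absolute continuity is what excludes them. Along a solution the right-hand side is
  continuous in time, so its integral is differentiable at every time of the half-line (one-sidedly
  at 0), and subtracting it reduces the question to a vanishing derivative. No differentiation
  theorem for vector-valued integrable functions enters.\<close>

text \<open>Completeness replaces compactness: by the parallelogram law every minimizing sequence is
  Cauchy, because convexity keeps midpoints in \<open>C\<close> and hence at distance at least
  \<open>d\<close> from \<open>x\<close>.\<close>

lemma closest_point_exists_complete:
  fixes C :: "'a::{real_inner, complete_space} set"
  assumes "C \<noteq> {}" "closed C" "convex C"
  obtains y where "y \<in> C" "\<forall>z\<in>C. dist x y \<le> dist x z"
proof -
  define d where "d = infdist x C"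
  have d_le: "d \<le> dist x z" if "z \<in> C" for z
    using that by (simp add: d_def infdist_le)
  have "\<exists>z\<in>C. dist x z < d + inverse (real (Suc n))" for n
  proof (rule ccontr)
    assume "\<not> ?thesis"
    then have "d + inverse (real (Suc n)) \<le> d"
      unfolding d_def infdist_notempty[OF assms(1)]
      by (intro cINF_greatest) (use assms(1) in \<open>auto simp: not_less\<close>)
    then show False
      using inverse_positive_iff_positive[of "real (Suc n)"] by linarith
  qed
  then obtain y where y: "\<And>n. y n \<in> C" "\<And>n. dist x (y n) < d + inverse (real (Suc n))"
    by metis
  have "(\<lambda>n. dist x (y n)) \<longlonglongrightarrow> d"
  proof (rule tendsto_sandwich[OF _ _ tendsto_const])
    show "(\<lambda>n. d + inverse (real (Suc n))) \<longlonglongrightarrow> d"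
      using tendsto_add[OF tendsto_const[of d] LIMSEQ_inverse_real_of_nat] by simp
  qed (use y d_le in \<open>auto intro!: always_eventually less_imp_le simp del: of_nat_Suc\<close>)
  then have lim: "(\<lambda>n. (dist x (y n))\<^sup>2) \<longlonglongrightarrow> d\<^sup>2"
    by (rule tendsto_power)
  have parallelogram: "(dist (y m) (y n))\<^sup>2 \<le> 2 * (dist x (y m))\<^sup>2 + 2 * (dist x (y n))\<^sup>2 - 4 * d\<^sup>2" for m n
  proof -
    have "(1/2) *\<^sub>R y m + (1/2) *\<^sub>R y n \<in> C"
      using y(1) assms(3) by (intro convexD) auto
    then have mid: "d\<^sup>2 \<le> (dist x ((1/2) *\<^sub>R y m + (1/2) *\<^sub>R y n))\<^sup>2"
      by (intro power_mono d_le) (auto simp: d_def infdist_nonneg)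
    have law: "(dist u v)\<^sup>2 = 2 * (dist x u)\<^sup>2 + 2 * (dist x v)\<^sup>2
        - 4 * (dist x ((1/2) *\<^sub>R u + (1/2) *\<^sub>R v))\<^sup>2" for u v
    proof -
      have mid: "x - ((1/2) *\<^sub>R u + (1/2) *\<^sub>R v) = (1/2) *\<^sub>R ((x - u) + (x - v))"
        by (simp add: scaleR_add_right scaleR_diff_right flip: scaleR_add_left)
      show ?thesis
        unfolding dist_norm mid
        by (simp only: power2_norm_eq_inner inner_diff_left inner_diff_right inner_add_left
            inner_add_right inner_scaleR_left inner_scaleR_right) (simp add: inner_commute field_simps)
    qed
    from mid law[of "y m" "y n"] show ?thesis by linarith
  qed
  have "Cauchy y"
  proof (rule metric_CauchyI)
    fix e :: real assume "e > 0"
    \<comment> \<open>Inserting this bound for both indices into the parallelogram inequality leaves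
      exactly \<open>e^2\<close>.\<close>
    then have "d\<^sup>2 < d\<^sup>2 + e\<^sup>2 / 4" by simp
    from order_tendstoD(2)[OF lim this] obtain N
      where N: "\<And>n. n \<ge> N \<Longrightarrow> (dist x (y n))\<^sup>2 < d\<^sup>2 + e\<^sup>2 / 4"
      by (auto simp: eventually_sequentially)
    have "dist (y m) (y n) < e" if "m \<ge> N" "n \<ge> N" for m n
      using parallelogram[of m n] N[OF that(1)] N[OF that(2)] \<open>e > 0\<close>
      by (intro power_less_imp_less_base[of _ 2 e]) auto
    then show "\<exists>M. \<forall>m\<ge>M. \<forall>n\<ge>M. dist (y m) (y n) < e" by blast
  qed
  then obtain l where l: "y \<longlonglongrightarrow> l"
    using Cauchy_convergent convergent_def by blast
  have "l \<in> C"
    using closed_sequentially[OF assms(2)] y(1) l by blast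
  moreover have "dist x l = d"
    using LIMSEQ_unique[OF tendsto_dist[OF tendsto_const l] \<open>(\<lambda>n. dist x (y n)) \<longlonglongrightarrow> d\<close>] .
  ultimately show thesis
    using that d_le by blast
qed

lemma metric_proj_closest:
  fixes C :: "'a::{real_inner, complete_space} set"
  assumes "C \<noteq> {}" "closed C" "convex C"
  shows "metric_proj C x \<in> C \<and> (\<forall>z\<in>C. dist x (metric_proj C x) \<le> dist x z)"
proof -
  obtain y where "y \<in> C" "\<forall>z\<in>C. dist x y \<le> dist x z"
    using closest_point_exists_complete[OF assms] .
  then have "\<exists>!y. y \<in> C \<and> (\<forall>z\<in>C. dist x y \<le> dist x z)"
    using any_closest_point_unique[OF assms(3,2)] by blast
  then show ?thesis
    unfolding metric_proj_def by (rule theI')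
qed

lemma metric_proj_dot:
  fixes C :: "'a::{real_inner, complete_space} set"
  assumes "C \<noteq> {}" "closed C" "convex C" "z \<in> C"
  shows "inner (x - metric_proj C x) (z - metric_proj C x) \<le> 0"
  using metric_proj_closest[OF assms(1-3), of x] assms
  by (intro any_closest_point_dot[of C]) auto

text \<open>Each projection is used as a test point in the obtuse-angle inequality of the other;
  adding the two and applying Cauchy-Schwarz gives the claim after cancelling one factor.\<close>

lemma metric_proj_nonexpansive:
  fixes C :: "'a::{real_inner, complete_space} set"
  assumes "C \<noteq> {}" "closed C" "convex C"
  shows "norm (metric_proj C x - metric_proj C y) \<le> norm (x - y)"
proof -
  define p q where "p = metric_proj C x" and "q = metric_proj C y"
  have "inner (x - p) (q - p) \<le> 0" "inner (y - q) (p - q) \<le> 0"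
    unfolding p_def q_def using metric_proj_dot[OF assms] metric_proj_closest[OF assms] by blast+
  moreover have "inner (p - q) (p - q)
      = inner (x - y) (p - q) + inner (x - p) (q - p) + inner (y - q) (p - q)"
    by (simp add: algebra_simps inner_commute)
  ultimately have "(norm (p - q))\<^sup>2 \<le> inner (x - y) (p - q)"
    by (simp add: power2_norm_eq_inner)
  also have "\<dots> \<le> norm (x - y) * norm (p - q)"
    by (rule norm_cauchy_schwarz)
  finally have "norm (p - q) * norm (p - q) \<le> norm (x - y) * norm (p - q)"
    by (simp add: power2_eq_square)
  then show ?thesis
    unfolding p_def[symmetric] q_def[symmetric]
    by (cases "p = q") (simp_all add: mult_le_cancel_right)
qed

lemma norm_blinfun_inner_left:
  fixes y :: "'a::real_inner"
  shows "norm (blinfun_inner_left y) = norm y"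
proof (rule antisym)
  show "norm (blinfun_inner_left y) \<le> norm y"
    by (rule norm_blinfun_bound) (simp_all add: Cauchy_Schwarz_ineq2 mult.commute[of "norm y"])
  have "norm y * norm y = norm (blinfun_apply (blinfun_inner_left y) y)"
    by (simp add: power2_norm_eq_inner flip: power2_eq_square)
  also have "\<dots> \<le> norm (blinfun_inner_left y) * norm y"
    by (rule norm_blinfun)
  finally show "norm y \<le> norm (blinfun_inner_left y)"
    by (cases "y = 0") (simp_all add: mult_le_cancel_right)
qed

text \<open>The representing vector spans the orthogonal complement of the kernel, and is found by
  projecting a point \<open>u\<close> outside the kernel onto it.\<close>

lemma riesz_representation:
  fixes \<phi> :: "'a::{real_inner, complete_space} \<Rightarrow>\<^sub>L real"
  obtains y where "\<phi> = blinfun_inner_left y"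
proof (cases "\<phi> = 0")
  case True
  then have "\<phi> = blinfun_inner_left 0"
    by (intro blinfun_eqI) simp
  then show thesis by (rule that)
next
  case False
  then obtain u where u: "blinfun_apply \<phi> u \<noteq> 0"
    by (metis blinfun_eqI zero_blinfun.rep_eq)
  define Z where "Z = {x. blinfun_apply \<phi> x = 0}"
  have "0 \<in> Z" by (simp add: Z_def blinfun.zero_right)
  moreover have "closed Z"
    unfolding Z_def
    by (rule closed_Collect_eq[OF linear_continuous_on[OF blinfun.bounded_linear_right] continuous_on_const])
  moreover have "convex Z"
    by (rule convexI) (simp add: Z_def blinfun.add_right blinfun.scaleR_right)
  ultimately have Z: "Z \<noteq> {}" "closed Z" "convex Z" by auto
  define p where "p = metric_proj Z u"
  define w where "w = u - p"
  have p: "blinfun_apply \<phi> p = 0"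
    using metric_proj_closest[OF Z, of u] by (simp add: p_def Z_def)
  \<comment> \<open>The kernel is a subspace, so \<open>p + v\<close> is an admissible test point
    for the projection; using \<open>- v\<close> as well turns the inequality into
    orthogonality.\<close>
  have le: "inner w v \<le> 0" if "blinfun_apply \<phi> v = 0" for v
    using metric_proj_dot[OF Z, of "p + v" u] that p
    by (simp add: w_def flip: p_def) (simp add: Z_def blinfun.add_right)
  have orth: "inner w v = 0" if "blinfun_apply \<phi> v = 0" for v
    using le[OF that] le[of "- v"] that by (simp add: blinfun.minus_right)
  have w: "blinfun_apply \<phi> w = blinfun_apply \<phi> u"
    by (simp add: w_def blinfun.diff_right p)
  have "w \<noteq> 0" using w u by (auto simp: blinfun.zero_right)
  \<comment> \<open>Subtracting from \<open>x\<close> the multiple of \<open>w\<close> with the same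
    value under \<open>\<phi>\<close> lands in the kernel, hence orthogonal to \<open>w\<close>;
    this dictates the scalar.\<close>
  have "\<phi> = blinfun_inner_left ((blinfun_apply \<phi> w / inner w w) *\<^sub>R w)"
  proof (rule blinfun_eqI)
    fix x
    have "inner w (x - (blinfun_apply \<phi> x / blinfun_apply \<phi> w) *\<^sub>R w) = 0"
      by (rule orth) (use w u in \<open>simp add: blinfun.diff_right blinfun.scaleR_right\<close>)
    then show "blinfun_apply \<phi> x = blinfun_apply (blinfun_inner_left ((blinfun_apply \<phi> w / inner w w) *\<^sub>R w)) x"
      using w u \<open>w \<noteq> 0\<close> by (simp add: inner_diff_right inner_commute field_simps)
  qed
  then show thesis by (rule that)
qed

section \<open>Absolutely continuous functions\<close>

definition nonoverlapping :: "real set \<Rightarrow> (real \<times> real) set \<Rightarrow> bool" where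
  "nonoverlapping I S \<longleftrightarrow> finite S \<and> (\<forall>(a,b)\<in>S. a \<le> b \<and> {a..b} \<subseteq> I)
     \<and> disjoint_family_on (\<lambda>(a,b). {a<..<b}) S"

lemma absolutely_continuous_on_iff:
  "absolutely_continuous_on I f \<longleftrightarrow> (\<forall>e>0. \<exists>d>0. \<forall>S. nonoverlapping I S \<longrightarrow>
     (\<Sum>(a,b)\<in>S. b - a) < d \<longrightarrow> (\<Sum>(a,b)\<in>S. norm (f b - f a)) < e)"
  unfolding absolutely_continuous_on_def nonoverlapping_def imp_conjL conj_assoc ..

lemma lipschitz_imp_absolutely_continuous_on:
  fixes f :: "real \<Rightarrow> 'a::real_normed_vector"
  assumes lip: "\<And>s t. \<lbrakk>s \<in> I; t \<in> I; s \<le> t\<rbrakk> \<Longrightarrow> norm (f t - f s) \<le> B * (t - s)"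
  shows "absolutely_continuous_on I f"
  unfolding absolutely_continuous_on_iff
proof (intro allI impI)
  fix e :: real assume "e > 0"
  \<comment> \<open>\<open>B\<close> may be zero (it is for constant functions), so a positive bound
    is needed for the division.\<close>
  define D where "D = \<bar>B\<bar> + 1"
  have "D > 0" by (simp add: D_def)
  show "\<exists>d>0. \<forall>S. nonoverlapping I S \<longrightarrow> (\<Sum>(a,b)\<in>S. b - a) < d
      \<longrightarrow> (\<Sum>(a,b)\<in>S. norm (f b - f a)) < e"
  proof (intro exI[of _ "e / D"] conjI allI impI)
    show "e / D > 0" using \<open>e > 0\<close> \<open>D > 0\<close> by simp
    fix S :: "(real \<times> real) set"
    assume S: "nonoverlapping I S" "(\<Sum>(a,b)\<in>S. b - a) < e / D"
    have "(\<Sum>(a,b)\<in>S. norm (f b - f a)) \<le> (\<Sum>(a,b)\<in>S. D * (b - a))"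
    proof (rule sum_mono, clarify)
      fix a b assume "(a, b) \<in> S"
      then have ab: "a \<in> I" "b \<in> I" "a \<le> b" using S(1) by (fastforce simp: nonoverlapping_def)+
      then have "norm (f b - f a) \<le> B * (b - a)" by (rule lip)
      also have "\<dots> \<le> D * (b - a)" using ab by (intro mult_right_mono) (auto simp: D_def)
      finally show "norm (f b - f a) \<le> D * (b - a)" .
    qed
    also have "\<dots> = D * (\<Sum>(a,b)\<in>S. b - a)"
      by (simp add: sum_distrib_left case_prod_unfold)
    also have "\<dots> < e" using S \<open>D > 0\<close> by (simp add: field_simps)
    finally show "(\<Sum>(a,b)\<in>S. norm (f b - f a)) < e" .
  qed
qed

lemma absolutely_continuous_on_diff:
  assumes f: "absolutely_continuous_on I f" and g: "absolutely_continuous_on I g"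
  shows "absolutely_continuous_on I (\<lambda>t. f t - g t)"
  unfolding absolutely_continuous_on_iff
proof (intro allI impI)
  fix e :: real assume "e > 0"
  then have "e / 2 > 0" by simp
  obtain d1 where "d1 > 0" and d1: "\<forall>S. nonoverlapping I S \<longrightarrow> (\<Sum>(a,b)\<in>S. b - a) < d1
      \<longrightarrow> (\<Sum>(a,b)\<in>S. norm (f b - f a)) < e / 2"
    using f \<open>e / 2 > 0\<close> unfolding absolutely_continuous_on_iff by blast
  obtain d2 where "d2 > 0" and d2: "\<forall>S. nonoverlapping I S \<longrightarrow> (\<Sum>(a,b)\<in>S. b - a) < d2
      \<longrightarrow> (\<Sum>(a,b)\<in>S. norm (g b - g a)) < e / 2"
    using g \<open>e / 2 > 0\<close> unfolding absolutely_continuous_on_iff by blast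
  have "(\<Sum>(a,b)\<in>S. norm (f b - g b - (f a - g a))) < e"
    if S: "nonoverlapping I S"
      and le: "(\<Sum>(a,b)\<in>S. b - a) < min d1 d2" for S
  proof -
    have "(\<Sum>(a,b)\<in>S. norm (f b - g b - (f a - g a)))
        \<le> (\<Sum>(a,b)\<in>S. norm (f b - f a) + norm (g b - g a))"
    proof (rule sum_mono, clarify)
      fix a b
      show "norm (f b - g b - (f a - g a)) \<le> norm (f b - f a) + norm (g b - g a)"
        using norm_triangle_ineq4[of "f b - f a" "g b - g a"] by (simp add: algebra_simps)
    qed
    also have "\<dots> = (\<Sum>(a,b)\<in>S. norm (f b - f a)) + (\<Sum>(a,b)\<in>S. norm (g b - g a))"
      by (simp add: sum.distrib case_prod_unfold)
    also have "\<dots> < e"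
      using d1[rule_format, OF S] d2[rule_format, OF S] le by simp
    finally show ?thesis .
  qed
  then show "\<exists>d>0. \<forall>S. nonoverlapping I S \<longrightarrow> (\<Sum>(a,b)\<in>S. b - a) < d
      \<longrightarrow> (\<Sum>(a,b)\<in>S. norm (f b - g b - (f a - g a))) < e"
    using \<open>d1 > 0\<close> \<open>d2 > 0\<close> by (intro exI[of _ "min d1 d2"]) auto
qed

lemma absolutely_continuous_on_eq:
  assumes f: "absolutely_continuous_on I f" and eq: "\<And>t. t \<in> I \<Longrightarrow> f t = g t"
  shows "absolutely_continuous_on I g"
proof -
  have "(\<Sum>(a,b)\<in>S. norm (g b - g a)) = (\<Sum>(a,b)\<in>S. norm (f b - f a))" if "nonoverlapping I S" for S
  proof (rule sum.cong[OF refl], clarify)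
    fix a b assume "(a, b) \<in> S"
    then have "a \<in> I" "b \<in> I"
      using that by (fastforce simp: nonoverlapping_def)+
    then show "norm (g b - g a) = norm (f b - f a)"
      by (simp add: eq)
  qed
  with f show ?thesis
    by (simp add: absolutely_continuous_on_iff cong: imp_cong)
qed

lemma absolutely_continuous_on_imp_continuous_on:
  assumes f: "absolutely_continuous_on {a..b} f"
  shows "continuous_on {a..b} f"
proof (rule continuous_onI)
  fix x and e :: real assume x: "x \<in> {a..b}" and "e > 0"
  obtain d where "d > 0" and d: "\<forall>S. nonoverlapping {a..b} S \<longrightarrow> (\<Sum>(u,v)\<in>S. v - u) < d
      \<longrightarrow> (\<Sum>(u,v)\<in>S. norm (f v - f u)) < e"
    using f \<open>e > 0\<close> unfolding absolutely_continuous_on_iff by blast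
  have "dist (f y) (f x) \<le> e" if "y \<in> {a..b}" "dist y x < d" for y
  proof -
    have close: "norm (f v - f u) < e" if "a \<le> u" "u \<le> v" "v \<le> b" "v - u < d" for u v
      using d[rule_format, of "{(u, v)}"] that
      by (simp add: nonoverlapping_def disjoint_family_on_def)
    show ?thesis
      using that x close[of x y] close[of y x]
      by (cases "x \<le> y") (auto simp: dist_norm norm_minus_commute)
  qed
  with \<open>d > 0\<close> show "\<exists>d>0. \<forall>y\<in>{a..b}. dist y x < d \<longrightarrow> dist (f y) (f x) \<le> e" by blast
qed

text \<open>A gauge argument: around the exceptional null set the gauge stays inside an open set of small
  measure, where absolute continuity controls the increments; elsewhere the vanishing derivative does.\<close>
lemma absolutely_continuous_on_zero_derivative_AE:
  fixes f :: "real \<Rightarrow> 'a::real_normed_vector"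
  assumes ac: "absolutely_continuous_on {a..b} f" and "a \<le> b"
    and deriv: "AE t in lborel. t \<in> {a..b} \<longrightarrow> (f has_vector_derivative 0) (at t within {a..b})"
  shows "f b = f a"
proof -
  obtain N where N: "N \<in> null_sets lborel"
    "\<And>t. t \<in> {a..b} \<Longrightarrow> t \<notin> N \<Longrightarrow> (f has_vector_derivative 0) (at t within {a..b})"
    using deriv by (auto elim!: AE_E3 simp: space_lborel)
  \<comment> \<open>The term \<open>e * (b - a)\<close> collects the intervals tagged off
    \<open>N\<close>, the extra \<open>e\<close> those tagged in \<open>N\<close>.\<close>
  have bound: "norm (f b - f a) \<le> e * (b - a) + e" if "e > 0" for e :: real
  proof -
    obtain d where "d > 0" and d: "\<forall>S. nonoverlapping {a..b} S \<longrightarrow> (\<Sum>(u,v)\<in>S. v - u) < d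
      \<longrightarrow> (\<Sum>(u,v)\<in>S. norm (f v - f u)) < e"
    using ac \<open>e > 0\<close> unfolding absolutely_continuous_on_iff by blast
    have N_leb: "N \<in> null_sets lebesgue"
      using N(1) by (rule null_sets_completionI)
    obtain U where U: "open U" "N \<subseteq> U" "U - N \<in> lmeasurable" "emeasure lebesgue (U - N) < ennreal d"
      using sets_lebesgue_outer_open[OF null_setsD2[OF N_leb] \<open>d > 0\<close>] by blast
    \<comment> \<open>Outer regularity makes only \<open>U - N\<close> small; nullity of
      \<open>N\<close> passes this on to \<open>U\<close>, whose two measures agree because it is
      open.\<close>
    have "emeasure lebesgue U = emeasure lebesgue (U - N)"
      using emeasure_Diff_null_set[OF N_leb, of U] U(1) by simp
    then have em: "emeasure lborel U < ennreal d"
      using U(1,4) by simp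
    then have Ufm: "U \<in> fmeasurable lborel"
      using U(1) by (intro fmeasurableI) (auto intro: less_trans[OF _ ennreal_less_top])
    have mU: "measure lborel U < d"
      using em \<open>d > 0\<close> by (simp add: emeasure_eq_measure2[OF Ufm] ennreal_less_iff)
    have "\<exists>r>0. (t \<in> N \<longrightarrow> ball t r \<subseteq> U) \<and> (t \<in> {a..b} \<longrightarrow> t \<notin> N \<longrightarrow>
        (\<forall>s\<in>{a..b}. \<bar>s - t\<bar> < r \<longrightarrow> norm (f s - f t) \<le> e * \<bar>s - t\<bar>))" for t
    proof (cases "t \<in> N")
      case True
      then show ?thesis using U(1,2) by (meson openE subsetD)
    next
      case False
      show ?thesis
      proof (cases "t \<in> {a..b}")
        case True
        from N(2)[OF True False] \<open>e > 0\<close> False True show ?thesis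
          unfolding has_vector_derivative_def has_derivative_within_alt by auto
      qed (use False in \<open>auto intro: exI[of _ 1]\<close>)
    qed
    then obtain r where r: "\<And>t. r t > 0" "\<And>t. t \<in> N \<Longrightarrow> ball t (r t) \<subseteq> U"
      "\<And>t s. t \<in> {a..b} \<Longrightarrow> t \<notin> N \<Longrightarrow> s \<in> {a..b} \<Longrightarrow> \<bar>s - t\<bar> < r t \<Longrightarrow> norm (f s - f t) \<le> e * \<bar>s - t\<bar>"
      by metis
    have "gauge (\<lambda>t. ball t (r t))"
      using r(1) by (simp add: gauge_def)
    then obtain p where p: "p tagged_division_of {a..b}" and fine: "(\<lambda>t. ball t (r t)) fine p"
      by (rule fine_division_exists_real)
    have "finite p" using p by auto
    have piece: "\<exists>u v. k = {u..v} \<and> u \<le> x \<and> x \<le> v \<and> a \<le> u \<and> v \<le> b \<and> {u..v} \<subseteq> ball x (r x)"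
      if xk: "(x, k) \<in> p" for x k
    proof -
      obtain u v where uv: "k = {u..v}"
        using tagged_division_ofD(4)[OF p xk] by auto
      moreover have "x \<in> k" "k \<subseteq> {a..b}"
        using tagged_division_ofD(2,3)[OF p xk] by auto
      moreover have "k \<subseteq> ball x (r x)" using fine xk by (auto simp: fine_def)
      ultimately show ?thesis by fastforce
    qed
    define g where "g = (\<lambda>(x::real, k). f (Sup k) - f (Inf k))"
    \<comment> \<open>Degenerate intervals tagged in \<open>N\<close> contribute nothing to the
      telescoping sum. Splitting them off as \<open>p3\<close> leaves in \<open>p2\<close> only
      intervals that can be told apart by their nonempty interiors.\<close>
    define p1 where "p1 = {z \<in> p. fst z \<notin> N}"
    define p2 where "p2 = {z \<in> p. fst z \<in> N \<and> interior (snd z) \<noteq> {}}"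
    define p3 where "p3 = {z \<in> p. fst z \<in> N \<and> interior (snd z) = {}}"
    have "f b - f a = sum g p"
      using additive_tagged_division_1[OF \<open>a \<le> b\<close> p, of f] by (simp add: g_def)
    also have "p = p1 \<union> p2 \<union> p3" by (auto simp: p1_def p2_def p3_def)
    also have "sum g (p1 \<union> p2 \<union> p3) = sum g p1 + sum g p2 + sum g p3"
    proof -
      have "finite p1" "finite p2" "finite p3" "p1 \<inter> p2 = {}" "(p1 \<union> p2) \<inter> p3 = {}"
        using \<open>finite p\<close> by (auto simp: p1_def p2_def p3_def)
      then show ?thesis by (simp add: sum.union_disjoint)
    qed
    also have "sum g p3 = 0"
    proof (rule sum.neutral, clarify)
      fix x k assume xk: "(x, k) \<in> p3"
      then obtain u v where "k = {u..v}" "u \<le> v"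
        using piece[of x k] by (fastforce simp: p3_def)
      with xk show "g (x, k) = 0"
        by (auto simp: p3_def g_def)
    qed
    finally have split: "f b - f a = sum g p1 + sum g p2" by simp
    have "norm (sum g p1) \<le> (\<Sum>z\<in>p1. e * measure lborel (snd z))"
    proof (rule sum_norm_le, clarify)
      fix x k assume xk: "(x, k) \<in> p1"
      then have "(x, k) \<in> p" "x \<notin> N" by (auto simp: p1_def)
      from piece[OF this(1)] obtain u v where uv: "k = {u..v}" "u \<le> x" "x \<le> v" "a \<le> u" "v \<le> b"
        "{u..v} \<subseteq> ball x (r x)" by blast
      have "u \<in> ball x (r x)" "v \<in> ball x (r x)" using uv by (force intro: subsetD[OF uv(6)])+
      then have "norm (f u - f x) \<le> e * \<bar>u - x\<bar>" "norm (f v - f x) \<le> e * \<bar>v - x\<bar>"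
        using uv(2-5) \<open>x \<notin> N\<close> by (intro r(3); simp add: dist_real_def abs_minus_commute)+
      \<comment> \<open>The tag lies between the endpoints, so the two errors add up to exactly
        \<open>e * (v - u)\<close>.\<close>
      then have "norm (f v - f u) \<le> e * (x - u) + e * (v - x)"
        using norm_triangle_ineq4[of "f v - f x" "f u - f x"] uv by simp
      then show "norm (g (x, k)) \<le> e * measure lborel (snd (x, k))"
        using uv by (simp add: g_def algebra_simps)
    qed
    also have "\<dots> \<le> (\<Sum>z\<in>p. e * measure lborel (snd z))"
      using \<open>finite p\<close> \<open>e > 0\<close> by (intro sum_mono2) (auto simp: p1_def)
    also have "\<dots> = e * (b - a)"
      using additive_content_tagged_division[of p a b] p \<open>a \<le> b\<close>
      by (simp add: sum_distrib_left[symmetric] case_prod_unfold)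
    finally have b1: "norm (sum g p1) \<le> e * (b - a)" .
    define h where "h = (\<lambda>(x::real, k::real set). (Inf k, Sup k))"
    have p2: "\<exists>u v. k = {u..v} \<and> u < v \<and> a \<le> u \<and> v \<le> b \<and> {u..v} \<subseteq> U \<and> h (x, k) = (u, v)
        \<and> interior k = {u<..<v}"
      if "(x, k) \<in> p2" for x k
    proof -
      from that have "(x, k) \<in> p" "x \<in> N" "interior k \<noteq> {}" by (auto simp: p2_def)
      from piece[OF this(1)] obtain u v where uv: "k = {u..v}" "u \<le> x" "x \<le> v" "a \<le> u" "v \<le> b"
        "{u..v} \<subseteq> ball x (r x)" by blast
      then have "u < v" using \<open>interior k \<noteq> {}\<close> by (cases "u < v") auto
      then show ?thesis
        using uv r(2)[OF \<open>x \<in> N\<close>] by (intro exI[of _ u] exI[of _ v]) (auto simp: h_def)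
    qed
    have disj: "interior k \<inter> interior k' = {}" if "(x, k) \<in> p2" "(x', k') \<in> p2" "(x, k) \<noteq> (x', k')" for x k x' k'
      using tagged_division_ofD(5)[OF p, of x k x' k'] that by (auto simp: p2_def)
    \<comment> \<open>\<open>h\<close> forgets the tag. One interval carrying two tags would overlap
      itself, which is impossible for a nonempty interior.\<close>
    have inj: "inj_on h p2"
    proof (rule inj_onI, clarify)
      fix x k x' k' assume *: "(x, k) \<in> p2" "(x', k') \<in> p2" "h (x, k) = h (x', k')"
      then have "k = k'" using p2[OF *(1)] p2[OF *(2)] by auto
      then show "x = x' \<and> k = k'" using disj[OF *(1,2)] *(1) by (auto simp: p2_def)
    qed
    have h_mem: "\<exists>x k. (x, k) \<in> p2 \<and> (u, v) = h (x, k) \<and> u < v \<and> a \<le> u \<and> v \<le> b \<and> {u..v} \<subseteq> U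
        \<and> interior k = {u<..<v}" if "(u, v) \<in> h ` p2" for u v
      using that p2 by fastforce
    have fin: "finite (h ` p2)" using \<open>finite p\<close> by (simp add: p2_def)
    have dis: "disjoint_family_on (\<lambda>(u, v). {u<..<v}) (h ` p2)"
      unfolding disjoint_family_on_def
    proof (intro ballI impI)
      fix i j assume ij: "i \<in> h ` p2" "j \<in> h ` p2" "i \<noteq> j"
      obtain u v u' v' where [simp]: "i = (u, v)" "j = (u', v')" by (cases i, cases j)
      from h_mem[of u v] ij obtain x k where *: "(x, k) \<in> p2" "i = h (x, k)" "interior k = {u<..<v}"
        by auto
      from h_mem[of u' v'] ij obtain x' k' where **: "(x', k') \<in> p2" "j = h (x', k')" "interior k' = {u'<..<v'}"
        by auto
      have "(x, k) \<noteq> (x', k')" using *(2) **(2) ij(3) by blast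
      from disj[OF *(1) **(1) this] show "(case i of (u, v) \<Rightarrow> {u<..<v}) \<inter> (case j of (u, v) \<Rightarrow> {u<..<v}) = {}"
        using *(3) **(3) by simp
    qed
    \<comment> \<open>Disjointness turns the total length into the measure of a union contained in
      \<open>U\<close>, hence less than \<open>d\<close>.\<close>
    have "(\<Sum>(u,v)\<in>h ` p2. v - u) = (\<Sum>i\<in>h ` p2. measure lborel (case i of (u, v) \<Rightarrow> {u<..<v}))"
      by (rule sum.cong) (auto dest!: h_mem)
    also have "\<dots> = measure lborel (\<Union>i\<in>h ` p2. case i of (u, v) \<Rightarrow> {u<..<v})"
    proof (rule measure_finite_Union[symmetric, OF fin _ dis])
      fix i assume "i \<in> h ` p2"
      then show "emeasure lborel (case i of (u, v) \<Rightarrow> {u<..<v}) \<noteq> \<infinity>"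
        by (cases i) (auto dest!: h_mem)
    qed (auto split: prod.splits)
    also have "\<dots> \<le> measure lborel U"
      using fin by (intro measure_mono_fmeasurable Ufm) (fastforce dest!: h_mem split: prod.splits)+
    finally have "(\<Sum>(u,v)\<in>h ` p2. v - u) < d" using mU by simp
    moreover have "nonoverlapping {a..b} (h ` p2)"
      unfolding nonoverlapping_def
    proof (intro conjI fin dis ballI)
      fix i assume "i \<in> h ` p2"
      then show "case i of (u, v) \<Rightarrow> u \<le> v \<and> {u..v} \<subseteq> {a..b}"
        using h_mem[of "fst i" "snd i"] by (auto simp: case_prod_unfold)
    qed
    ultimately have "(\<Sum>(u,v)\<in>h ` p2. norm (f v - f u)) < e"
      using d by blast
    then have "(\<Sum>z\<in>p2. norm (g z)) < e"
      unfolding sum.reindex[OF inj] by (simp add: g_def h_def case_prod_unfold)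
    then have "norm (sum g p2) \<le> e"
      using norm_sum[of g p2] by linarith
    with b1 show ?thesis
      unfolding split using norm_triangle_ineq[of "sum g p1" "sum g p2"] by linarith
  qed
  have "norm (f b - f a) \<le> 0"
  proof (rule field_le_epsilon)
    fix e :: real assume "e > 0"
    \<comment> \<open>The summand 1 accounts for the extra \<open>e\<close> in \<open>bound\<close>
      and keeps the denominator positive when \<open>a = b\<close>.\<close>
    with \<open>a \<le> b\<close> have "e / (b - a + 1) > 0" by simp
    from bound[OF this] have "norm (f b - f a) \<le> e / (b - a + 1) * (b - a + 1)"
      by (simp only: distrib_left mult_1_right)
    with \<open>a \<le> b\<close> show "norm (f b - f a) \<le> 0 + e" by simp
  qed
  then show ?thesis by simp
qed

section \<open>Global solutions of Lipschitz equations\<close>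

text \<open>Reduces to the compact interval ending at \<open>t + 1\<close>: there \<open>t\<close>
  is not the right endpoint, so both within-filters coincide.\<close>

lemma has_vector_derivative_integral_atLeast:
  fixes g :: "real \<Rightarrow> 'b::banach"
  assumes "continuous_on {a..} g" "t \<ge> a"
  shows "((\<lambda>t. integral {a..t} g) has_vector_derivative g t) (at t within {a..})"
proof -
  have "((\<lambda>t. integral {a..t} g) has_vector_derivative g t) (at t within {a..t + 1})"
    using assms by (intro integral_has_vector_derivative) (auto intro: continuous_on_subset)
  moreover have "at t within {a..t + 1} = at t within {a..}"
    by (rule at_within_nhd[of t "{..<t + 1}"]) (use assms(2) in auto)
  ultimately show ?thesis by simp
qed

lemma integral_absolutely_continuous_on:
  fixes g :: "real \<Rightarrow> 'b::banach"
  assumes g: "continuous_on {a..T} g"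
  shows "absolutely_continuous_on {a..T} (\<lambda>t. integral {a..t} g)"
proof -
  obtain B where B: "\<forall>s\<in>{a..T}. norm (g s) \<le> B"
    using compact_imp_bounded[OF compact_continuous_image[OF g compact_Icc]] by (auto simp: bounded_iff)
  show ?thesis
  proof (rule lipschitz_imp_absolutely_continuous_on)
    fix s t :: real assume st: "s \<in> {a..T}" "t \<in> {a..T}" "s \<le> t"
    have "integral {a..s} g + integral {s..t} g = integral {a..t} g"
      using st by (intro Henstock_Kurzweil_Integration.integral_combine integrable_continuous_real continuous_on_subset[OF g]) auto
    then have "norm (integral {a..t} g - integral {a..s} g) = norm (integral {s..t} g)"
      by (metis add_diff_cancel_left')
    also have "\<dots> \<le> B * (t - s)"
      using st B by (intro integral_bound continuous_on_subset[OF g]) auto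
    finally show "norm (integral {a..t} g - integral {a..s} g) \<le> B * (t - s)" .
  qed
qed

text \<open>A single \<open>K\<close> serves as Lipschitz constant and as bound at the origin, so
  that \<open>norm (G t x)\<close> is at most \<open>K t * (1 + norm x)\<close>. Continuity is asked
  for only along continuous curves, the form in which integrands occur.\<close>

locale lipschitz_ode =
  fixes G :: "real \<Rightarrow> 'b::banach \<Rightarrow> 'b" and K :: "real \<Rightarrow> real"
  assumes K_cont: "continuous_on {0..} K"
    and G_lipschitz: "t \<ge> 0 \<Longrightarrow> norm (G t x - G t y) \<le> K t * norm (x - y)"
    and G_zero: "t \<ge> 0 \<Longrightarrow> norm (G t 0) \<le> K t"
    and G_cont: "continuous_on {0..} u \<Longrightarrow> continuous_on {0..} (\<lambda>t. G t (u t))"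
begin

lemma K_nonneg: "t \<ge> 0 \<Longrightarrow> K t \<ge> 0"
  using G_zero[of t] norm_ge_zero[of "G t 0"] by linarith

lemma G_integrable: "continuous_on {0..} u \<Longrightarrow> (\<lambda>s. G s (u s)) integrable_on {0..t}"
  by (intro integrable_continuous_real continuous_on_subset[OF G_cont]) auto

text \<open>The Bielecki weight: solutions are measured by the supremum of
  \<open>norm (x t) / weight t\<close>.\<close>

definition weight :: "real \<Rightarrow> real" where
  "weight t = exp (2 * integral {0..t} K)"

lemma weight_pos: "weight t > 0"
  by (simp add: weight_def)

lemma weight_0: "weight 0 = 1"
  by (simp add: weight_def)

lemma weight_has_derivative:
  assumes "t \<ge> 0"
  shows "(weight has_vector_derivative 2 * (K t * weight t)) (at t within {0..})"
  using has_vector_derivative_integral_atLeast[OF K_cont assms]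
  unfolding weight_def has_real_derivative_iff_has_vector_derivative[symmetric]
  by (auto intro!: derivative_eq_intros)

lemma weight_cont: "continuous_on {0..} weight"
  using weight_has_derivative
  by (auto intro!: has_vector_derivative_continuous simp: continuous_on_eq_continuous_within)

lemma weight_has_integral:
  assumes "t \<ge> 0"
  shows "((\<lambda>s. K s * weight s) has_integral (weight t - 1) / 2) {0..t}"
proof -
  have "((\<lambda>s. 2 * (K s * weight s)) has_integral (weight t - weight 0)) {0..t}"
    using assms
    by (intro fundamental_theorem_of_calculus)
      (auto intro: has_vector_derivative_within_subset[OF weight_has_derivative])
  from has_integral_mult_right[OF this, of "1 / 2"] show ?thesis
    by (simp add: weight_0)
qed

lemma weight_ge_1: "t \<ge> 0 \<Longrightarrow> weight t \<ge> 1"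
  using has_integral_nonneg[OF weight_has_integral[of t]] K_nonneg weight_pos
  by (force intro: mult_nonneg_nonneg less_imp_le)

text \<open>The weight is chosen so that integration gains the factor 1/2 in the weighted supremum norm.\<close>
lemma weighted_integral_bound:
  fixes h :: "real \<Rightarrow> 'b"
  assumes "t \<ge> 0" "h integrable_on {0..t}" "M \<ge> 0"
    and h: "\<And>s. s \<in> {0..t} \<Longrightarrow> norm (h s) \<le> M * (K s * weight s)"
  shows "norm (integral {0..t} h) \<le> M / 2 * weight t"
proof -
  have I: "((\<lambda>s. M * (K s * weight s)) has_integral M * ((weight t - 1) / 2)) {0..t}"
    by (intro has_integral_mult_right weight_has_integral assms)
  have "norm (integral {0..t} h) \<le> M * ((weight t - 1) / 2)"
    using integral_norm_bound_integral[OF assms(2) has_integral_integrable[OF I] h]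
    unfolding integral_unique[OF I] .
  also have "\<dots> \<le> M / 2 * weight t"
    using \<open>M \<ge> 0\<close> by (simp add: field_simps)
  finally show ?thesis .
qed

section \<open>Existence and uniqueness for the integral equation\<close>

definition integral_solution :: "'b \<Rightarrow> (real \<Rightarrow> 'b) \<Rightarrow> bool" where
  "integral_solution x0 x \<longleftrightarrow> continuous_on {0..} x
     \<and> (\<forall>t\<ge>0. x t = x0 + integral {0..t} (\<lambda>s. G s (x s)))"

text \<open>Writing the unknown as \<open>weight t *\<^sub>R u t\<close> turns the weighted supremum
  norm into the plain one, so the fixed point theorem applies in the complete space of bounded
  continuous functions.\<close>

lemma integral_solution_exists: "\<exists>x. integral_solution x0 x"
proof -
  define \<Phi> where "\<Phi> u t = x0 + integral {0..t} (\<lambda>s. G s (weight s *\<^sub>R u s))" for u t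
  have scaled_cont: "continuous_on {0..} (\<lambda>s. weight s *\<^sub>R apply_bcontfun u s)" for u :: "real \<Rightarrow>\<^sub>C 'b"
    by (intro continuous_intros weight_cont) auto
  have \<Phi>_cont: "continuous_on {0..} (\<Phi> (apply_bcontfun u))" for u
    unfolding \<Phi>_def
    using has_vector_derivative_integral_atLeast[OF G_cont[OF scaled_cont[of u]]]
    by (intro continuous_on_add continuous_on_const)
      (auto intro!: has_vector_derivative_continuous simp: continuous_on_eq_continuous_within)
  have \<Phi>_bound: "norm (\<Phi> (apply_bcontfun u) t) \<le> (norm x0 + (1 + B) / 2) * weight t"
    if "t \<ge> 0" and B: "B \<ge> 0" "\<And>s. norm (apply_bcontfun u s) \<le> B" for u t B
  proof -
    have "norm (integral {0..t} (\<lambda>s. G s (weight s *\<^sub>R apply_bcontfun u s))) \<le> (1 + B) / 2 * weight t"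
    proof (rule weighted_integral_bound[OF \<open>t \<ge> 0\<close> G_integrable[OF scaled_cont]])
      fix s assume s: "s \<in> {0..t}"
      have "norm (G s (weight s *\<^sub>R apply_bcontfun u s))
          \<le> norm (G s 0) + norm (G s (weight s *\<^sub>R apply_bcontfun u s) - G s 0)"
        by (rule norm_triangle_sub)
      also have "\<dots> \<le> K s + K s * (weight s * norm (apply_bcontfun u s))"
        using G_zero[of s] G_lipschitz[of s "weight s *\<^sub>R apply_bcontfun u s" 0] s weight_pos[of s] by simp
      \<comment> \<open>\<open>weight s >= 1\<close> lets the inhomogeneous term \<open>K s\<close>
        be absorbed into the weighted form.\<close>
      also have "\<dots> \<le> K s * weight s + K s * (weight s * B)"
        using s B weight_ge_1[of s] weight_pos[of s] K_nonneg[of s]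
        by (intro add_mono mult_left_mono mult_left_le) (auto simp: mult_le_cancel_left1)
      finally show "norm (G s (weight s *\<^sub>R apply_bcontfun u s)) \<le> (1 + B) * (K s * weight s)"
        by (simp add: algebra_simps)
    qed (use B in auto)
    moreover have "norm x0 \<le> norm x0 * weight t"
      using weight_ge_1[OF \<open>t \<ge> 0\<close>] by (simp add: mult_le_cancel_left1)
    ultimately show ?thesis
      unfolding \<Phi>_def distrib_right
      using norm_triangle_ineq[of x0 "integral {0..t} (\<lambda>s. G s (weight s *\<^sub>R apply_bcontfun u s))"]
      by linarith
  qed
  have \<Phi>_diff: "norm (\<Phi> (apply_bcontfun u) t - \<Phi> (apply_bcontfun v) t) \<le> dist u v / 2 * weight t"
    if "t \<ge> 0" for u v t
  proof -
    have "\<Phi> (apply_bcontfun u) t - \<Phi> (apply_bcontfun v) t = integral {0..t}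
        (\<lambda>s. G s (weight s *\<^sub>R apply_bcontfun u s) - G s (weight s *\<^sub>R apply_bcontfun v s))"
      unfolding \<Phi>_def by (subst integral_diff) (auto intro: G_integrable scaled_cont)
    also have "norm \<dots> \<le> dist u v / 2 * weight t"
    proof (rule weighted_integral_bound[OF that integrable_diff])
      fix s assume s: "s \<in> {0..t}"
      have "norm (G s (weight s *\<^sub>R apply_bcontfun u s) - G s (weight s *\<^sub>R apply_bcontfun v s))
          \<le> K s * norm (weight s *\<^sub>R (apply_bcontfun u s - apply_bcontfun v s))"
        unfolding scaleR_diff_right using s by (intro G_lipschitz) auto
      also have "\<dots> = K s * (weight s * dist (apply_bcontfun u s) (apply_bcontfun v s))"
        using weight_pos[of s] by (simp add: dist_norm)
      also have "\<dots> \<le> K s * (weight s * dist u v)"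
        using s K_nonneg[of s] weight_pos[of s] dist_bounded[of u s v] by (intro mult_left_mono) auto
      finally show "norm (G s (weight s *\<^sub>R apply_bcontfun u s) - G s (weight s *\<^sub>R apply_bcontfun v s))
          \<le> dist u v * (K s * weight s)"
        by (simp add: mult_ac)
    qed (auto intro: G_integrable scaled_cont)
    finally show ?thesis .
  qed
  \<comment> \<open>Bounded continuous functions live on the whole line, so negative times are
    clamped to 0. Dividing by the weight returns to the rescaled unknown.\<close>
  define T where "T u = Bcontfun (\<lambda>t. inverse (weight (max 0 t)) *\<^sub>R \<Phi> (apply_bcontfun u) (max 0 t))" for u
  have T: "apply_bcontfun (T u) t = inverse (weight (max 0 t)) *\<^sub>R \<Phi> (apply_bcontfun u) (max 0 t)" for u t
  proof -
    obtain B where B: "B \<ge> 0" "\<And>s. norm (apply_bcontfun u s) \<le> B"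
    proof -
      obtain B where "\<And>s. norm (apply_bcontfun u s) \<le> B"
        using bounded_apply_bcontfun[of u] by (auto simp: bounded_iff)
      then show thesis
        using that[of B] norm_ge_zero order_trans by blast
    qed
    have "(\<lambda>t. inverse (weight (max 0 t)) *\<^sub>R \<Phi> (apply_bcontfun u) (max 0 t)) \<in> bcontfun"
      unfolding bcontfun_def
    proof (intro CollectI conjI)
      show "continuous_on UNIV (\<lambda>t. inverse (weight (max 0 t)) *\<^sub>R \<Phi> (apply_bcontfun u) (max 0 t))"
        using weight_pos
        by (intro continuous_on_scaleR continuous_on_inverse continuous_on_compose2[OF weight_cont]
            continuous_on_compose2[OF \<Phi>_cont] continuous_on_max continuous_intros)
          (auto simp: less_imp_neq[symmetric])
      have "norm (inverse (weight (max 0 t)) *\<^sub>R \<Phi> (apply_bcontfun u) (max 0 t)) \<le> norm x0 + (1 + B) / 2" for t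
        using \<Phi>_bound[of "max 0 t" B u, OF _ B] weight_pos[of "max 0 t"] by (simp add: field_simps)
      then show "bounded (range (\<lambda>t. inverse (weight (max 0 t)) *\<^sub>R \<Phi> (apply_bcontfun u) (max 0 t)))"
        unfolding bounded_iff by blast
    qed
    then show ?thesis
      by (simp add: T_def Bcontfun_inverse)
  qed
  have "dist (T u) (T v) \<le> 1 / 2 * dist u v" for u v
  proof (rule dist_bound)
    fix t :: real
    let ?s = "max 0 t"
    have "dist (apply_bcontfun (T u) t) (apply_bcontfun (T v) t)
        = norm (\<Phi> (apply_bcontfun u) ?s - \<Phi> (apply_bcontfun v) ?s) / weight ?s"
      unfolding T dist_norm scaleR_diff_right[symmetric] norm_scaleR
      using weight_pos[of ?s] by (simp add: divide_inverse_commute)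
    also have "\<dots> \<le> 1 / 2 * dist u v"
      using \<Phi>_diff[of ?s u v] weight_pos[of ?s] by (simp add: divide_le_eq)
    finally show "dist (apply_bcontfun (T u) t) (apply_bcontfun (T v) t) \<le> 1 / 2 * dist u v" .
  qed
  then have "\<exists>!u. T u = u"
    by (intro banach_fix_type[of "1 / 2"]) auto
  then obtain u where u: "T u = u" by blast
  have "weight t *\<^sub>R apply_bcontfun u t = \<Phi> (apply_bcontfun u) t" if "t \<ge> 0" for t
    using T[of u t] that weight_pos[of t] by (simp add: u)
  then have "integral_solution x0 (\<lambda>t. weight t *\<^sub>R apply_bcontfun u t)"
    unfolding integral_solution_def \<Phi>_def using scaled_cont by blast
  then show ?thesis by blast
qed

text \<open>An arbitrary solution is not known in advance to be bounded relative to the weight, so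
  uniqueness of the fixed point does not cover it. On a compact interval the weighted difference
  \<open>d\<close> attains its maximum at some \<open>m\<close>, and the integral estimate there
  gives \<open>d m <= d m / 2\<close>.\<close>

lemma integral_solution_unique:
  assumes x: "integral_solution x0 x" and y: "integral_solution x0 y" and "t \<ge> 0"
  shows "x t = y t"
proof -
  define d where "d s = norm (x s - y s) / weight s" for s
  have cont: "continuous_on {0..} x" "continuous_on {0..} y"
    using x y by (auto simp: integral_solution_def)
  have "continuous_on {0..t} d"
    unfolding d_def using weight_pos
    by (intro continuous_intros continuous_on_subset[OF cont(1)] continuous_on_subset[OF cont(2)]
        continuous_on_subset[OF weight_cont]) (auto simp: less_imp_neq[symmetric])
  then obtain m where m: "m \<in> {0..t}" "\<And>s. s \<in> {0..t} \<Longrightarrow> d s \<le> d m"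
    using continuous_attains_sup[of "{0..t}" d] \<open>t \<ge> 0\<close> by auto
  have d_nonneg: "d s \<ge> 0" for s
    using weight_pos[of s] by (simp add: d_def)
  have eq: "norm (x s - y s) = d s * weight s" for s
    using weight_pos[of s] by (simp add: d_def)
  have "x m - y m = integral {0..m} (\<lambda>s. G s (x s) - G s (y s))"
    using x y m(1) cont
    by (subst integral_diff) (auto simp: integral_solution_def intro: G_integrable)
  also have "norm \<dots> \<le> d m / 2 * weight m"
  proof (rule weighted_integral_bound[OF _ integrable_diff])
    fix s assume s: "s \<in> {0..m}"
    have "norm (G s (x s) - G s (y s)) \<le> K s * (d s * weight s)"
      using G_lipschitz[of s "x s" "y s"] s by (simp add: eq)
    also have "\<dots> \<le> K s * (d m * weight s)"
      using s m K_nonneg[of s] weight_pos[of s] by (intro mult_left_mono mult_right_mono) auto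
    finally show "norm (G s (x s) - G s (y s)) \<le> d m * (K s * weight s)"
      by (simp add: mult_ac)
  qed (use m(1) cont d_nonneg in \<open>auto intro: G_integrable\<close>)
  finally have "d m * weight m \<le> d m / 2 * weight m"
    by (simp add: eq)
  then have "d m \<le> 0"
    using weight_pos[of m] by (simp add: mult_le_0_iff)
  then have "d t = 0"
    using m(2)[of t] d_nonneg[of t] \<open>t \<ge> 0\<close> by simp
  then show ?thesis
    using eq[of t] by simp
qed

section \<open>Integral solutions and strong solutions coincide\<close>

lemma integral_solution_imp_strong:
  assumes x: "integral_solution x0 x"
  shows "strong_global_solution G x0 x"
proof -
  let ?g = "\<lambda>s. G s (x s)"
  have cont: "continuous_on {0..} ?g"
    using x by (intro G_cont) (simp add: integral_solution_def)
  have x_eq: "x t = x0 + integral {0..t} ?g" if "t \<ge> 0" for t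
    using x that by (simp add: integral_solution_def)
  have ac: "absolutely_continuous_on {0..T} x" for T
  proof -
    have "absolutely_continuous_on {0..T} (\<lambda>t. integral {0..t} ?g)"
      by (intro integral_absolutely_continuous_on continuous_on_subset[OF cont]) auto
    \<comment> \<open>The constant is added as the difference with \<open>- x0\<close>, to fit the
      closure under differences.\<close>
    moreover have "absolutely_continuous_on {0..T} (\<lambda>t. - x0)"
      by (rule lipschitz_imp_absolutely_continuous_on[of _ _ 0]) auto
    ultimately have "absolutely_continuous_on {0..T} (\<lambda>t. integral {0..t} ?g - - x0)"
      by (rule absolutely_continuous_on_diff)
    then show ?thesis
      by (rule absolutely_continuous_on_eq) (simp add: x_eq)
  qed
  have "(x has_vector_derivative ?g t) (at t)" if "t > 0" for t
  proof -
    have "((\<lambda>t. x0 + integral {0..t} ?g) has_vector_derivative 0 + ?g t) (at t within {0..})"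
      using that by (intro has_vector_derivative_add has_vector_derivative_const
          has_vector_derivative_integral_atLeast cont) auto
    then have "((\<lambda>t. x0 + integral {0..t} ?g) has_vector_derivative ?g t) (at t within {0..})"
      by simp
    then have "(x has_vector_derivative ?g t) (at t within {0..})"
      by (rule has_vector_derivative_transform[rotated 2]) (use that x_eq in simp_all)
    moreover have "at t within {0..} = at t"
      by (rule at_within_interior) (use that in simp)
    ultimately show ?thesis by simp
  qed
  \<comment> \<open>At 0 the integral equation controls only the right derivative; this single point
    is a null set.\<close>
  then have "AE t in lborel. t \<ge> 0 \<longrightarrow> (x has_vector_derivative ?g t) (at t)"
    by (intro eventually_mono[OF AE_lborel_singleton[of 0]]) simp
  with ac show ?thesis
    unfolding strong_global_solution_def using x_eq[of 0] by simp
qed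

lemma strong_imp_integral_solution:
  assumes x: "strong_global_solution G x0 x"
  shows "integral_solution x0 x"
proof -
  let ?g = "\<lambda>s. G s (x s)"
  have ac: "absolutely_continuous_on {0..T} x" if "T \<ge> 0" for T
    using x that by (simp add: strong_global_solution_def)
  have deriv: "AE t in lborel. t \<ge> 0 \<longrightarrow> (x has_vector_derivative ?g t) (at t)"
    using x by (simp add: strong_global_solution_def)
  have x_cont: "continuous_on {0..} x"
    unfolding continuous_on_eq_continuous_within
  proof
    fix t :: real assume t: "t \<in> {0..}"
    then have "continuous (at t within {0..t + 1}) x"
      using absolutely_continuous_on_imp_continuous_on[OF ac[of "t + 1"]]
      by (auto simp: continuous_on_eq_continuous_within)
    moreover have "at t within {0..t + 1} = at t within {0..}"
      by (rule at_within_nhd[of t "{..<t + 1}"]) (use t in auto)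
    ultimately show "continuous (at t within {0..}) x" by simp
  qed
  then have cont: "continuous_on {0..} ?g"
    by (rule G_cont)
  have "x t = x0 + integral {0..t} ?g" if "t \<ge> 0" for t
  proof -
    let ?f = "\<lambda>s. x s - integral {0..s} ?g"
    have "absolutely_continuous_on {0..t} ?f"
      using that by (intro absolutely_continuous_on_diff ac integral_absolutely_continuous_on
          continuous_on_subset[OF cont]) auto
    moreover have "AE s in lborel. s \<in> {0..t} \<longrightarrow> (?f has_vector_derivative 0) (at s within {0..t})"
      using deriv
    proof eventually_elim
      case (elim s)
      show ?case
      proof
        assume s: "s \<in> {0..t}"
        then have "(x has_vector_derivative ?g s) (at s within {0..t})"
          using elim by (auto intro: has_vector_derivative_at_within)
        moreover have "((\<lambda>s. integral {0..s} ?g) has_vector_derivative ?g s) (at s within {0..t})"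
          using s by (intro has_vector_derivative_within_subset[OF
              has_vector_derivative_integral_atLeast[OF cont]]) auto
        ultimately show "(?f has_vector_derivative 0) (at s within {0..t})"
          by (rule has_vector_derivative_diff[THEN has_vector_derivative_eq_rhs]) simp
      qed
    qed
    ultimately have "?f t = ?f 0"
      using that by (intro absolutely_continuous_on_zero_derivative_AE)
    then show ?thesis
      using x by (simp add: strong_global_solution_def algebra_simps)
  qed
  with x_cont show ?thesis
    by (simp add: integral_solution_def)
qed

lemma strong_global_solution_exists_unique:
  "\<exists>x. strong_global_solution G x0 x \<and> (\<forall>z. strong_global_solution G x0 z \<longrightarrow> (\<forall>t\<ge>0. z t = x t))"
proof -
  obtain x where x: "integral_solution x0 x"
    using integral_solution_exists by blast
  have "z t = x t" if "strong_global_solution G x0 z" "t \<ge> 0" for z t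
    using integral_solution_unique[OF strong_imp_integral_solution[OF that(1)] x that(2)] .
  with integral_solution_imp_strong[OF x] show ?thesis by blast
qed

end

section \<open>The Cauchy problem in Hilbert space\<close>

text \<open>Absolute continuity sees only norms of increments, and bounded linear maps commute with
  derivatives. It is applied both to the Riesz map and to its inverse.\<close>

lemma strong_global_solution_isometry:
  assumes J: "bounded_linear J" "\<And>y. norm (J y) = norm y"
    and eq: "\<And>t y. G' t (J y) = J (G t y)"
    and x: "strong_global_solution G x0 x"
  shows "strong_global_solution G' (J x0) (\<lambda>t. J (x t))"
proof -
  have "norm (J u - J v) = norm (u - v)" for u v
    by (simp add: J(2) flip: linear_diff[OF bounded_linear.linear[OF J(1)]])
  moreover have "AE t in lborel. t \<ge> 0 \<longrightarrow> ((\<lambda>t. J (x t)) has_vector_derivative G' t (J (x t))) (at t)"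
    using x bounded_linear.has_vector_derivative[OF J(1)]
    by (auto simp: strong_global_solution_def eq elim!: eventually_mono)
  ultimately show ?thesis
    using x by (simp add: strong_global_solution_def absolutely_continuous_on_def)
qed

text \<open>The sort \<open>{real_inner, complete_space}\<close> does not entail the class \<open>banach\<close>, on which integration is
  developed. The dual space is in that class, and the Riesz isometry carries the result back.\<close>
lemma hilbert_strong_global_solution_exists_unique:
  fixes G :: "real \<Rightarrow> 'a::{real_inner, complete_space} \<Rightarrow> 'a"
  assumes K_cont: "continuous_on {0..} K"
    and lip: "\<And>t x y. t \<ge> 0 \<Longrightarrow> norm (G t x - G t y) \<le> K t * norm (x - y)"
    and zero: "\<And>t. t \<ge> 0 \<Longrightarrow> norm (G t 0) \<le> K t"
    and cont: "\<And>u. continuous_on {0..} u \<Longrightarrow> continuous_on {0..} (\<lambda>t. G t (u t))"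
  shows "\<exists>x. strong_global_solution G x0 x \<and> (\<forall>z. strong_global_solution G x0 z \<longrightarrow> (\<forall>t\<ge>0. z t = x t))"
proof -
  define J :: "'a \<Rightarrow> 'a \<Rightarrow>\<^sub>L real" where "J = blinfun_inner_left"
  have J: "bounded_linear J" "norm (J y) = norm y" for y
    by (simp_all add: J_def bounded_linear_blinfun_inner_left norm_blinfun_inner_left)
  interpret J: bounded_linear J by (rule J)
  have "inj J"
  proof (rule injI)
    fix u v assume "J u = J v"
    then have "norm (u - v) = 0"
      by (simp add: J.diff flip: J(2))
    then show "u = v" by simp
  qed
  have "surj J"
    unfolding surj_def J_def by (metis riesz_representation)
  define R where "R = inv J"
  have RJ: "R (J y) = y" and JR: "J (R \<phi>) = \<phi>" for y \<phi>
    using \<open>inj J\<close> \<open>surj J\<close> by (simp_all add: R_def surj_f_inv_f)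
  have norm_R: "norm (R \<phi>) = norm \<phi>" for \<phi>
    using J(2)[of "R \<phi>"] by (simp add: JR)
  have R: "bounded_linear R"
  \<comment> \<open>Linearity of the inverse: write the right-hand side as \<open>R\<close> of its
    image under \<open>J\<close> and use linearity of \<open>J\<close>.\<close>
  proof (rule bounded_linear_intro[where K = 1])
    show "R (\<phi> + \<psi>) = R \<phi> + R \<psi>" for \<phi> \<psi>
      using RJ[of "R \<phi> + R \<psi>"] by (simp add: J.add JR)
    show "R (r *\<^sub>R \<phi>) = r *\<^sub>R R \<phi>" for r \<phi>
      using RJ[of "r *\<^sub>R R \<phi>"] by (simp add: J.scaleR JR)
  qed (simp add: norm_R)
  interpret R: bounded_linear R by (rule R)
  define G' where "G' t \<phi> = J (G t (R \<phi>))" for t \<phi>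
  interpret lipschitz_ode G' K
  proof
    show "norm (G' t \<phi> - G' t \<psi>) \<le> K t * norm (\<phi> - \<psi>)" if "t \<ge> 0" for t \<phi> \<psi>
      using lip[OF that, of "R \<phi>" "R \<psi>"] by (simp add: G'_def J(2) norm_R flip: J.diff R.diff)
    show "norm (G' t 0) \<le> K t" if "t \<ge> 0" for t
      using zero[OF that] by (simp add: G'_def J(2) R.zero)
    show "continuous_on {0..} (\<lambda>t. G' t (u t))" if "continuous_on {0..} u" for u
      unfolding G'_def by (intro J.continuous_on cont R.continuous_on that)
  qed (rule K_cont)
  obtain x where x: "strong_global_solution G' (J x0) x"
    "\<And>z t. strong_global_solution G' (J x0) z \<Longrightarrow> t \<ge> 0 \<Longrightarrow> z t = x t"
    using strong_global_solution_exists_unique[of "J x0"] by blast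
  have "strong_global_solution G (R (J x0)) (\<lambda>t. R (x t))"
    by (rule strong_global_solution_isometry[OF R norm_R _ x(1)]) (simp add: G'_def RJ)
  moreover have "z t = R (x t)" if "strong_global_solution G x0 z" "t \<ge> 0" for z t
  proof -
    have "strong_global_solution G' (J x0) (\<lambda>t. J (z t))"
      by (rule strong_global_solution_isometry[OF J _ that(1)]) (simp add: G'_def RJ)
    from x(2)[OF this \<open>t \<ge> 0\<close>] show ?thesis
      by (metis RJ)
  qed
  ultimately show ?thesis
    by (auto simp: RJ)
qed

theorem theorem3p3:
  fixes C :: "'a::{real_inner, complete_space} set"
    and A F :: "'a \<Rightarrow> 'a"
    and lam L_A L_F :: real
    and \<alpha> \<mu> :: "real \<Rightarrow> real"
    and x0 :: 'a
  assumes C_ne: "C \<noteq> {}" and C_closed: "closed C" and C_convex: "convex C"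
    and A1_sm: "strongly_monotone lam A"
    and A1_LA: "lipschitz_on L_A UNIV A"
    and A1_LF: "lipschitz_on L_F UNIV F"
    and A1_wA: "seq_weak_weak_continuous A"
    and A1_wF: "seq_weak_weak_continuous F"
    and A2: "monotone_couple A F"
    and A3_ne: "GVI_Sol A F C \<noteq> {}"
    and A3_cvx: "convex (A ` GVI_Sol A F C)"
    and \<alpha>_cont: "continuous_on {0..} \<alpha>" and \<alpha>_pos: "\<forall>t\<ge>0. \<alpha> t > 0"
    and \<mu>_cont: "continuous_on {0..} \<mu>" and \<mu>_pos: "\<forall>t\<ge>0. \<mu> t > 0"
  shows "\<exists>x. strong_global_solution
              (\<lambda>t y. metric_proj C ((F y + \<alpha> t *\<^sub>R y) - \<mu> t *\<^sub>R A y) - (F y + \<alpha> t *\<^sub>R y)) x0 x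
           \<and> (\<forall>z. strong_global_solution
              (\<lambda>t y. metric_proj C ((F y + \<alpha> t *\<^sub>R y) - \<mu> t *\<^sub>R A y) - (F y + \<alpha> t *\<^sub>R y)) x0 z
                  \<longrightarrow> (\<forall>t\<ge>0. z t = x t))"
proof -
  define B where "B t y = F y + \<alpha> t *\<^sub>R y" for t y
  define D where "D t y = B t y - \<mu> t *\<^sub>R A y" for t y
  define G where "G t y = metric_proj C (D t y) - B t y" for t y
  have F_lip: "norm (F x - F y) \<le> L_F * norm (x - y)" and A_lip: "norm (A x - A y) \<le> L_A * norm (x - y)" for x y
    using lipschitz_onD[OF A1_LF] lipschitz_onD[OF A1_LA] by (simp_all add: dist_norm)
  have F_cont: "continuous_on UNIV F" and A_cont: "continuous_on UNIV A"
    using A1_LF A1_LA by (auto intro: lipschitz_on_continuous_on)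
  have proj_cont: "continuous_on UNIV (metric_proj C)"
    by (rule lipschitz_on_continuous_on[of 1])
      (auto intro!: lipschitz_onI metric_proj_nonexpansive[OF C_ne C_closed C_convex] simp: dist_norm)
  have G_cont: "continuous_on {0..} (\<lambda>t. G t (u t))" if "continuous_on {0..} u" for u
    unfolding G_def D_def B_def
    by (intro continuous_intros \<alpha>_cont \<mu>_cont that continuous_on_compose2[OF proj_cont]
        continuous_on_compose2[OF F_cont] continuous_on_compose2[OF A_cont]) auto
  have B_lip: "norm (B t x - B t y) \<le> (L_F + \<alpha> t) * norm (x - y)" if "t \<ge> 0" for t x y
  proof -
    have "B t x - B t y = (F x - F y) + \<alpha> t *\<^sub>R (x - y)"
      by (simp add: B_def algebra_simps)
    also have "norm \<dots> \<le> norm (F x - F y) + norm (\<alpha> t *\<^sub>R (x - y))"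
      by (rule norm_triangle_ineq)
    also have "\<dots> \<le> L_F * norm (x - y) + \<alpha> t * norm (x - y)"
      using F_lip[of x y] \<alpha>_pos that by (simp add: abs_of_pos)
    finally show ?thesis by (simp add: distrib_right)
  qed
  have D_lip: "norm (D t x - D t y) \<le> (L_F + \<alpha> t + \<mu> t * L_A) * norm (x - y)" if "t \<ge> 0" for t x y
  proof -
    have "D t x - D t y = (B t x - B t y) - \<mu> t *\<^sub>R (A x - A y)"
      by (simp add: D_def algebra_simps)
    also have "norm \<dots> \<le> norm (B t x - B t y) + norm (\<mu> t *\<^sub>R (A x - A y))"
      by (rule norm_triangle_ineq4)
    also have "\<dots> \<le> (L_F + \<alpha> t) * norm (x - y) + \<mu> t * (L_A * norm (x - y))"
      using B_lip[OF that, of x y] A_lip[of x y] \<mu>_pos that by (simp add: abs_of_pos add_mono)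
    finally show ?thesis by (simp add: algebra_simps)
  qed
  \<comment> \<open>The Lipschitz constants of \<open>D t\<close> and \<open>B t\<close> add up
    because the projection is nonexpansive; \<open>norm (G t 0)\<close> is included so that the same
    \<open>K\<close> bounds \<open>G\<close> at the origin.\<close>
  define K where "K t = (L_F + \<alpha> t + \<mu> t * L_A) + (L_F + \<alpha> t) + norm (G t 0)" for t
  have G_lip: "norm (G t x - G t y) \<le> K t * norm (x - y)" if "t \<ge> 0" for t x y
  proof -
    have "G t x - G t y = (metric_proj C (D t x) - metric_proj C (D t y)) - (B t x - B t y)"
      by (simp add: G_def)
    also have "norm \<dots> \<le> norm (metric_proj C (D t x) - metric_proj C (D t y)) + norm (B t x - B t y)"
      by (rule norm_triangle_ineq4)
    also have "\<dots> \<le> norm (D t x - D t y) + norm (B t x - B t y)"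
      by (intro add_right_mono metric_proj_nonexpansive C_ne C_closed C_convex)
    also have "\<dots> \<le> (L_F + \<alpha> t + \<mu> t * L_A) * norm (x - y) + (L_F + \<alpha> t) * norm (x - y)"
      by (intro add_mono D_lip B_lip that)
    also have "\<dots> \<le> \<dots> + norm (G t 0) * norm (x - y)"
      by simp
    finally show ?thesis by (simp add: K_def distrib_right)
  qed
  \<comment> \<open>The remaining summands of \<open>K t\<close> are nonnegative, by the signs of
    \<open>\<alpha>\<close>, \<open>\<mu>\<close> and the Lipschitz constants.\<close>
  have "norm (G t 0) \<le> K t" if "t \<ge> 0" for t
    using lipschitz_on_nonneg[OF A1_LF] lipschitz_on_nonneg[OF A1_LA] \<alpha>_pos \<mu>_pos that
    by (simp add: K_def less_imp_le)
  moreover have "continuous_on {0..} K"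
    unfolding K_def by (intro continuous_intros \<alpha>_cont \<mu>_cont G_cont)
  ultimately have "\<exists>x. strong_global_solution G x0 x
      \<and> (\<forall>z. strong_global_solution G x0 z \<longrightarrow> (\<forall>t\<ge>0. z t = x t))"
    using G_lip G_cont by (intro hilbert_strong_global_solution_exists_unique[of K])
  then show ?thesis
    unfolding G_def D_def B_def .
qed

end
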